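(* Let $0<b<1/2<a<1$ with $a+b=1$, let $\rho=2\sqrt{ab}$, and let $K$ be the hub-and-two-spoke transition matrix on $S=\mathbb{Z}$, that is, the substochastic matrix with $K(0,1)=K(0,-1)=b/2$; $K(x,x+1)=b$ and $K(x,x-1)=a$ for $x\ge 1$; $K(x,x-1)=b$ and $K(x,x+1)=a$ for $x\le -1$; and all other entries equal to $0$. For $x\in\mathbb{Z}$ define $$\pi_x(y)=\begin{cases}\dfrac{1-\rho}{2a}\left(1+|y|+\dfrac{x}{1+|x|}\,y\right)\left(\sqrt{\dfrac{b}{a}}\right)^{|y|} & \text{for } y\in\mathbb{Z}\setminus\{0\},\\[2mm] \dfrac{1-\rho}{a} & \text{for } y=0.\end{cases}$$ Then $K$ is periodic with period $d=2$ and, for every starting state $x\in\mathbb{Z}$, $K$ has the periodic Yaglom limit $\pi_x$ starting from $x$. Equivalently, as $n\to\infty$, $$\frac{K^{2n}(x,y)}{K^{2n}(x,S)}\to\frac{\pi_x(y)}{\pi_x(2\mathbb{Z})}\quad\text{for $x$ even and $y$ even},$$ $$\frac{K^{2n+1}(x,y)}{K^{2n+1}(x,S)}\to\frac{\pi_x(y)}{\pi_x(2\mathbb{Z}+1)}\quad\text{for $x$ even and $y$ odd},$$ $$\frac{K^{2n}(x,y)}{K^{2n}(x,S)}\to\frac{\pi_x(y)}{\pi_x(2\mathbb{Z}+1)}\quad\text{for $x$ odd and $y$ odd},$$ $$\frac{K^{2n+1}(x,y)}{K^{2n+1}(x,S)}\to\frac{\pi_x(y)}{\pi_x(2\mathbb{Z})}\quad\text{for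 $x$ odd and $y$ even},$$ where $\pi_x(2\mathbb{Z})=\dfrac{1}{1+\rho}$ and $\pi_x(2\mathbb{Z}+1)=\dfrac{\rho}{1+\rho}$.
   Context: $K^n$ is the $n$-th matrix power of $K$, and for $A\subseteq S$, $K^n(x,A)=\sum_{y\in A}K^n(x,y)$; for a measure $\mu$ on $S$, $\mu(A)=\sum_{y\in A}\mu(y)$. The missing mass $1-K(0,S)=a$ in row $0$ represents a transition to an absorbing state outside $S$. The period of an irreducible $K$ is $d=\gcd\{n>0:K^n(x,x)>0\}$, independent of $x$. For $K$ irreducible with period $d>1$ and a fixed state $x$, partition $S$ into classes $S_0,\dots,S_{d-1}$ where $y\in S_k$ iff $K^{nd+k}(x,y)>0$ for all sufficiently large $n$. $K$ has the periodic Yaglom limit $\pi_x$ starting from $x$ if $\pi_x$ is a probability measure on $S$ with $\lim_{n\to\infty}K^{nd+k}(x,y)/K^{nd+k}(x,S)=\pi_x(y)/\pi_x(S_k)$ for all $k\in\{0,\dots,d-1\}$ and all $y\in S_k$. *)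

theory Defs
  imports "HOL-Analysis.Infinite_Sum"
begin

definition mass :: "('s \<Rightarrow> real) \<Rightarrow> 's set \<Rightarrow> real" where
  "mass \<mu> A = (\<Sum>\<^sub>\<infinity>y\<in>A. \<mu> y)"

definition substochastic :: "('s \<Rightarrow> 's \<Rightarrow> real) \<Rightarrow> bool" where
  "substochastic K \<longleftrightarrow>
     (\<forall>x y. 0 \<le> K x y) \<and> (\<forall>x. K x summable_on UNIV \<and> mass (K x) UNIV \<le> 1)"

definition probability_mass :: "('s \<Rightarrow> real) \<Rightarrow> bool" where
  "probability_mass \<mu> \<longleftrightarrow> (\<forall>y. 0 \<le> \<mu> y) \<and> (\<mu> has_sum 1) UNIV"

text \<open>
  The library has no infinite matrices, so a kernel on a state space is a function of two
  arguments. The series in the successor case converges whenever the kernel is substochastic.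
\<close>

primrec kernel_power :: "('s \<Rightarrow> 's \<Rightarrow> real) \<Rightarrow> nat \<Rightarrow> 's \<Rightarrow> 's \<Rightarrow> real" where
  "kernel_power K 0 x y = (if x = y then 1 else 0)"
| "kernel_power K (Suc n) x y = (\<Sum>\<^sub>\<infinity>z. K x z * kernel_power K n z y)"

definition irreducible_kernel :: "('s \<Rightarrow> 's \<Rightarrow> real) \<Rightarrow> bool" where
  "irreducible_kernel K \<longleftrightarrow> (\<forall>x y. \<exists>n. kernel_power K n x y > 0)"

definition period :: "('s \<Rightarrow> 's \<Rightarrow> real) \<Rightarrow> 's \<Rightarrow> nat" where
  "period K x = Gcd {n. n > 0 \<and> kernel_power K n x x > 0}"

definition cyclic_class :: "('s \<Rightarrow> 's \<Rightarrow> real) \<Rightarrow> 's \<Rightarrow> nat \<Rightarrow> 's set" where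
  "cyclic_class K x k =
     {y. \<forall>\<^sub>F n in sequentially. kernel_power K (n * period K x + k) x y > 0}"

text \<open>
  Meaningful for irreducible kernels of period greater than one. Then every cyclic class is
  nonempty and, for a state in the class, the denominators on the left are eventually positive.
\<close>

definition periodic_Yaglom_limit ::
    "('s \<Rightarrow> 's \<Rightarrow> real) \<Rightarrow> 's \<Rightarrow> ('s \<Rightarrow> real) \<Rightarrow> bool" where
  "periodic_Yaglom_limit K x \<pi> \<longleftrightarrow>
     probability_mass \<pi> \<and>
     (\<forall>k < period K x. \<forall>y \<in> cyclic_class K x k.
        (\<lambda>n. kernel_power K (n * period K x + k) x y
              / mass (kernel_power K (n * period K x + k) x) UNIV)
        \<longlonglongrightarrow> \<pi> y / mass \<pi> (cyclic_class K x k))"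

definition hub_two_spoke :: "real \<Rightarrow> real \<Rightarrow> int \<Rightarrow> int \<Rightarrow> real" where
  "hub_two_spoke a b x y =
     (if x = 0 then (if y = 1 \<or> y = -1 then b / 2 else 0)
      else if x \<ge> 1 then (if y = x + 1 then b else if y = x - 1 then a else 0)
      else (if y = x - 1 then b else if y = x + 1 then a else 0))"

definition spoke_rho :: "real \<Rightarrow> real \<Rightarrow> real" where
  "spoke_rho a b = 2 * sqrt (a * b)"

definition spoke_limit :: "real \<Rightarrow> real \<Rightarrow> int \<Rightarrow> int \<Rightarrow> real" where
  "spoke_limit a b x y =
     (if y = 0 then (1 - spoke_rho a b) / a
      else (1 - spoke_rho a b) / (2 * a)
           * (1 + \<bar>real_of_int y\<bar> + real_of_int x / (1 + \<bar>real_of_int x\<bar>) * real_of_int y)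
           * sqrt (b / a) ^ nat \<bar>y\<bar>)"

end

theory Submission
  imports Defs
begin

text \<open>
  With \<open>s = sqrt (a b)\<close> and \<open>r = sqrt (b / a)\<close>, every path of length \<open>n\<close> from \<open>x\<close> to \<open>y\<close>
  has weight \<open>s^n r^(|y| - |x|)\<close> up to the factor \<open>1/2\<close> paid at the hub, so that
  \<open>K^n(x,y)\<close> reduces to counting paths. Splitting into the parts even and odd under
  \<open>y \<mapsto> -y\<close>, the even part counts paths of \<open>|x|\<close> that stay nonnegative, while the odd part counts
  those killed at the hub, which is the same count with both endpoints shifted by one.
  The number of nonnegative paths from \<open>0\<close> to \<open>0\<close> is a Catalan number, whose ratios tend to \<open>4\<close>;
  solving the path recursion for the farther neighbour turns this into the asymptotic factor
  \<open>(x+1)(y+1)\<close> for all endpoints.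
  Mass is lost only at the hub, so the surviving mass decreases in step \<open>n\<close> by \<open>a K^n(x,0)\<close>, and
  the Stolz--Cesaro principle yields its asymptotics.
\<close>

subsection \<open>Sums and ratio limits\<close>

text \<open>Stolz--Cesaro in its 0/0 form. As \<open>q < 1\<close>, the weights tend to 0, hence so
  does \<open>u m - t * w m\<close> for each \<open>t\<close>. If \<open>t\<close> exceeds
  \<open>l / (1 - q)\<close>, this sequence eventually increases to 0 and so is eventually
  nonpositive; if \<open>t\<close> is smaller, all signs reverse.\<close>

lemma stolz_ratio:
  fixes u w :: "nat \<Rightarrow> real"
  assumes w: "\<And>m. 0 < w m" and q: "(\<lambda>m. w (Suc m) / w m) \<longlonglongrightarrow> q" "q < 1"
    and l: "(\<lambda>m. (u m - u (Suc m)) / w m) \<longlonglongrightarrow> l" and u: "u \<longlonglongrightarrow> 0"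
  shows "(\<lambda>m. u m / w m) \<longlonglongrightarrow> l / (1 - q)"
proof -
  obtain c where c: "q < c" "c < 1" using q(2) dense by blast
  have w_le: "\<forall>\<^sub>F m in sequentially. w (Suc m) < c * w m"
    using order_tendstoD(2)[OF q(1) c(1)] by eventually_elim (use w in \<open>simp add: divide_simps\<close>)
  have w0: "w \<longlonglongrightarrow> 0"
  proof -
    obtain N where N: "w (Suc m) < c * w m" if "m \<ge> N" for m
      using w_le by (auto simp: eventually_sequentially)
    have "summable w"
      by (rule summable_ratio_test[of c N]) (use c N w in \<open>auto simp: less_imp_le abs_of_pos\<close>)
    then show ?thesis by (rule summable_LIMSEQ_zero)
  qed
  have d: "(\<lambda>m. (u m - u (Suc m)) / w m - t * (1 - w (Suc m) / w m)) \<longlonglongrightarrow> l - t * (1 - q)" for t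
    by (intro tendsto_intros l q)
  have tele: "(u m - u (Suc m)) / w m - t * (1 - w (Suc m) / w m)
      = ((u m - t * w m) - (u (Suc m) - t * w (Suc m))) / w m" for m t
    using w[of m] by (simp add: field_simps)
  have z: "(\<lambda>m. u m - t * w m) \<longlonglongrightarrow> 0" for t
    using tendsto_diff[OF u tendsto_mult[OF tendsto_const w0]] by simp
  have upper: "\<forall>\<^sub>F m in sequentially. u m / w m \<le> t" if "l / (1 - q) < t" for t
  proof -
    have "l - t * (1 - q) < 0" using that q(2) by (simp add: field_simps)
    from order_tendstoD(2)[OF d this]
    obtain N where "((u m - t * w m) - (u (Suc m) - t * w (Suc m))) / w m < 0" if "m \<ge> N" for m
      by (auto simp: eventually_sequentially tele)
    then have N: "u m - t * w m \<le> u (Suc m) - t * w (Suc m)" if "m \<ge> N" for m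
      using that w[of m] by (fastforce simp: divide_less_0_iff)
    have "u m - t * w m \<le> 0" if "m \<ge> N" for m
    proof (rule LIMSEQ_le_const[OF z], intro exI allI impI)
      fix n assume "m \<le> n"
      then show "u m - t * w m \<le> u n - t * w n"
        using N that by (induction n rule: dec_induct) (auto intro: order_trans)
    qed
    then show ?thesis
      using w by (auto simp: eventually_sequentially field_simps intro!: exI[of _ N])
  qed
  have lower: "\<forall>\<^sub>F m in sequentially. t \<le> u m / w m" if "t < l / (1 - q)" for t
  proof -
    have "0 < l - t * (1 - q)" using that q(2) by (simp add: field_simps)
    from order_tendstoD(1)[OF d this]
    obtain N where "0 < ((u m - t * w m) - (u (Suc m) - t * w (Suc m))) / w m" if "m \<ge> N" for m
      by (auto simp: eventually_sequentially tele)
    then have N: "u (Suc m) - t * w (Suc m) \<le> u m - t * w m" if "m \<ge> N" for m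
      using that w[of m] by (fastforce simp: zero_less_divide_iff)
    have "0 \<le> u m - t * w m" if "m \<ge> N" for m
    proof (rule LIMSEQ_le_const2[OF z], intro exI allI impI)
      fix n assume "m \<le> n"
      then show "u n - t * w n \<le> u m - t * w m"
        using N that by (induction n rule: dec_induct) (auto intro: order_trans)
    qed
    then show ?thesis
      using w by (auto simp: eventually_sequentially field_simps intro!: exI[of _ N])
  qed
  show ?thesis
  proof (rule order_tendstoI)
    fix t assume "t < l / (1 - q)"
    then obtain t' where "t < t'" "t' < l / (1 - q)" using dense by blast
    with lower[of t'] show "\<forall>\<^sub>F m in sequentially. t < u m / w m" by (auto elim: eventually_mono)
  next
    fix t assume "l / (1 - q) < t"
    then obtain t' where "t' < t" "l / (1 - q) < t'" using dense by blast
    with upper[of t'] show "\<forall>\<^sub>F m in sequentially. u m / w m < t" by (auto elim: eventually_mono)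
  qed
qed

text \<open>Folds a sum over the integers along the absolute value. By nonnegativity, each half is
  summable by comparison with the paired series.\<close>

lemma has_sum_int_from_nat:
  fixes f :: "int \<Rightarrow> real"
  assumes nonneg: "\<And>z. 0 \<le> f z"
    and sum: "((\<lambda>k. if k = 0 then f 0 else f (int k) + f (- int k)) has_sum S) A"
  shows "(f has_sum S) {z. nat \<bar>z\<bar> \<in> A}"
proof -
  \<comment> \<open>The value 0 at \<open>k = 0\<close> keeps \<open>f 0\<close> from being counted
    in both halves.\<close>
  define g where "g k = (if k = 0 then 0 else f (- int k))" for k
  have summable: "(\<lambda>k. if k = 0 then f 0 else f (int k) + f (- int k)) summable_on A"
    using sum by (rule has_sum_imp_summable)
  have "(\<lambda>k. f (int k)) summable_on A" "g summable_on A"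
    by (rule summable_on_comparison_test[OF summable]; simp add: nonneg g_def)+
  then obtain P N where P: "((\<lambda>k. f (int k)) has_sum P) A" and N: "(g has_sum N) A"
    by (auto simp: summable_on_def)
  have "((\<lambda>k. f (int k) + g k) has_sum P + N) A"
    by (rule has_sum_add[OF P N])
  moreover have "(\<lambda>k. f (int k) + g k) = (\<lambda>k. if k = 0 then f 0 else f (int k) + f (- int k))"
    by (auto simp: g_def)
  ultimately have S: "S = P + N" using sum has_sum_unique by metis
  have P': "(f has_sum P) (int ` A)"
    using P by (subst has_sum_reindex) (auto simp: o_def)
  have "(g has_sum N) A \<longleftrightarrow> ((\<lambda>k. f (- int k)) has_sum N) (A - {0})"
    by (rule has_sum_cong_neutral) (auto simp: g_def)
  with N have N': "(f has_sum N) ((\<lambda>k. - int k) ` (A - {0}))"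
    by (subst has_sum_reindex) (auto simp: o_def inj_on_def)
  have "(f has_sum S) (int ` A \<union> (\<lambda>k. - int k) ` (A - {0}))"
    unfolding S by (rule has_sum_Un_disjoint[OF P' N']) auto
  moreover have "int ` A \<union> (\<lambda>k. - int k) ` (A - {0}) = {z. nat \<bar>z\<bar> \<in> A}"
  proof (intro equalityI subsetI)
    fix z assume z: "z \<in> {z. nat \<bar>z\<bar> \<in> A}"
    show "z \<in> int ` A \<union> (\<lambda>k. - int k) ` (A - {0})"
    proof (cases "0 \<le> z")
      case True
      then have "z = int (nat \<bar>z\<bar>)" by simp
      then show ?thesis using z by blast
    next
      case False
      then have "z = - int (nat \<bar>z\<bar>)" "nat \<bar>z\<bar> \<in> A - {0}" using z by auto
      then show ?thesis by blast
    qed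
  qed auto
  ultimately show ?thesis by simp
qed

subsection \<open>Nonnegative lattice paths\<close>

text \<open>Counts nearest-neighbour walks on the nonnegative integers, unfolded at the first step;
  at 0 the step down is forbidden. The counts are real because they are only used in quotients and
  asymptotics.\<close>

primrec paths :: "nat \<Rightarrow> nat \<Rightarrow> nat \<Rightarrow> real" where
  "paths 0 x y = (if x = y then 1 else 0)"
| "paths (Suc n) x y = paths n (Suc x) y + (case x of 0 \<Rightarrow> 0 | Suc x' \<Rightarrow> paths n x' y)"

lemmas paths_Suc = paths.simps(2)
declare paths_Suc [simp del]

text \<open>Unfolding at the last step leaves the start fixed, so that walks from 0 can be treated
  by recursion on their endpoint.\<close>

lemma paths_Suc_right:
  "paths (Suc n) x y = paths n x (Suc y) + (case y of 0 \<Rightarrow> 0 | Suc y' \<Rightarrow> paths n x y')"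
proof (induction n arbitrary: x)
  case 0
  show ?case by (auto simp: paths_Suc split: nat.split)
next
  case (Suc n)
  show ?case
  proof (cases x)
    case 0
    have "paths (Suc (Suc n)) x y = paths (Suc n) 1 y"
      using 0 by (simp add: paths_Suc[of "Suc n"])
    then show ?thesis
      using Suc.IH[of 1] 0 by (simp add: paths_Suc[of n 0] split: nat.split)
  next
    case (Suc z)
    have "paths (Suc (Suc n)) x y = paths (Suc n) (Suc x) y + paths (Suc n) z y"
      using Suc by (simp add: paths_Suc[of "Suc n"])
    then show ?thesis
      using Suc.IH[of "Suc x"] Suc.IH[of z] Suc by (simp add: paths_Suc[of n "Suc z"] split: nat.split)
  qed
qed

lemma paths_eq_0: "odd (n + x + y) \<Longrightarrow> paths n x y = 0"
proof (induction n arbitrary: x)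
  case (Suc n)
  have "paths n (Suc x) y = 0" using Suc.prems by (intro Suc.IH) simp
  moreover have "paths n z y = 0" if "x = Suc z" for z using Suc.prems that by (intro Suc.IH) simp
  ultimately show ?case by (simp add: paths_Suc split: nat.split)
qed auto

lemma paths_eq_0_of_less: "n + x < y \<Longrightarrow> paths n x y = 0"
  by (induction n arbitrary: x) (auto simp: paths_Suc split: nat.split)

text \<open>These are the ballot numbers, with \<open>k\<close> the number of down steps. They
  satisfy the last-step recursion, so induction on the length proves the formula for all
  \<open>k\<close> and \<open>y\<close> at once.\<close>

lemma paths_from_0: "paths (2 * k + y) 0 y = real (y + 1) * fact (2 * k + y) / (fact k * fact (k + y + 1))"
proof (induction "2 * k + y" arbitrary: k y)
  case 0
  then show ?case by simp
next
  case (Suc n)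
  show ?case
  proof (cases y)
    case 0
    then obtain j where k: "k = Suc j" using Suc.hyps(2) by (cases k) auto
    have n: "n = 2 * j + 1" using Suc.hyps(2) 0 k by simp
    have "paths (2 * k + y) 0 y = paths (2 * j + 1) 0 1"
      unfolding Suc.hyps(2)[symmetric] unfolding n 0 by (simp add: paths_Suc_right)
    also have "\<dots> = 2 * fact (2 * j + 1) / (fact j * fact (j + 2))"
      using Suc.hyps(1)[of j 1] n by simp
    also have "\<dots> = real (y + 1) * fact (2 * k + y) / (fact k * fact (k + y + 1))"
      using 0 k by (simp add: divide_simps)
    finally show ?thesis .
  next
    case y: (Suc z)
    have n: "n = 2 * k + z" using Suc.hyps(2) y by simp
    have 1: "paths (2 * k + y) 0 y = paths n 0 (Suc y) + paths n 0 z"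
      unfolding Suc.hyps(2)[symmetric] unfolding y by (simp add: paths_Suc_right)
    have 2: "paths n 0 z = real (z + 1) * fact (2 * k + z) / (fact k * fact (k + z + 1))"
      using Suc.hyps(1)[of k z] n by simp
    show ?thesis
    proof (cases k)
      \<comment> \<open>Without down steps the walk only climbs, so the upper neighbour of
        \<open>y\<close> is out of reach after \<open>n\<close> steps.\<close>
      case 0
      then have "paths n 0 (Suc y) = 0" using n y by (intro paths_eq_0_of_less) simp
      then show ?thesis using 1 2 0 y by (simp add: divide_simps)
    next
      case k: (Suc j)
      \<comment> \<open>Factorials common to all three terms; once they are split off, a rational
        identity in \<open>j\<close> and \<open>z\<close> remains.\<close>
      define F G H :: real where "F = fact (2 * j + z + 2)" and "G = fact j" and "H = fact (j + z + 2)"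
      have pos: "F > 0" "G > 0" "H > 0" by (simp_all add: F_def G_def H_def)
      have "paths n 0 (Suc y) = real (y + 2) * fact (2 * j + Suc y) / (fact j * fact (j + y + 2))"
        using Suc.hyps(1)[of j "Suc y"] n k y by simp
      also have "\<dots> = (real z + 3) * F / (G * ((real j + real z + 3) * H))"
        by (simp add: F_def G_def H_def y algebra_simps)
      finally have 3: "paths n 0 (Suc y) = (real z + 3) * F / (G * ((real j + real z + 3) * H))" .
      have 4: "paths n 0 z = (real z + 1) * F / ((real j + 1) * G * H)"
        by (simp add: 2 F_def G_def H_def k algebra_simps)
      have 5: "real (y + 1) * fact (2 * k + y) / (fact k * fact (k + y + 1))
          = (real z + 2) * ((2 * real j + real z + 3) * F)
            / ((real j + 1) * G * ((real j + real z + 3) * H))"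
        by (simp add: F_def G_def H_def k y algebra_simps)
      show ?thesis
        unfolding 1 3 4 5 using pos by (simp add: divide_simps) (simp add: algebra_simps)
    qed
  qed
qed

abbreviation catalan :: "nat \<Rightarrow> real" where "catalan m \<equiv> paths (2 * m) 0 0"

lemma catalan_eq: "catalan m = fact (2 * m) / (fact m * fact (m + 1))"
  using paths_from_0[of m 0] by simp

lemma catalan_pos: "0 < catalan m"
  by (simp only: catalan_eq) simp

lemma catalan_ratio: "catalan (Suc m) / catalan m = 4 - 6 / (real m + 2)"
  by (simp only: catalan_eq) (simp add: divide_simps, simp add: algebra_simps)

lemma catalan_shift_tendsto: "(\<lambda>m. catalan (m + k) / catalan m) \<longlonglongrightarrow> 4 ^ k"
proof (induction k)
  case 0
  show ?case using catalan_pos by (simp add: less_imp_neq[symmetric])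
next
  case (Suc k)
  have "(\<lambda>m. 6 / (real m + 2)) \<longlonglongrightarrow> 0"
    by (rule real_tendsto_divide_at_top[OF tendsto_const
          filterlim_at_top_mono[OF filterlim_real_sequentially]]) simp
  from tendsto_diff[OF tendsto_const this] have "(\<lambda>m. 4 - 6 / (real m + 2)) \<longlonglongrightarrow> 4" by simp
  then have "(\<lambda>m. catalan (Suc m) / catalan m) \<longlonglongrightarrow> 4"
    by (simp only: catalan_ratio)
  then have "(\<lambda>m. catalan (Suc (m + k)) / catalan (m + k)) \<longlonglongrightarrow> 4"
    by (rule LIMSEQ_ignore_initial_segment)
  moreover have "catalan (m + k) \<noteq> 0" for m
    using catalan_pos[of "m + k"] by simp
  ultimately show ?case
    using tendsto_mult[OF _ Suc.IH] by fastforce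
qed

text \<open>Solving the recursion for the farther neighbour gives the linear factor:
  \<open>2 * (z + 1) - z = z + 2\<close>. Each such step raises the time offset by one, so
  \<open>e\<close> must stay arbitrary in the induction. For the other parity the counts vanish by
  \<open>paths_eq_0\<close>.\<close>

lemma paths_tendsto:
  assumes "even (x + y + e)"
  shows "(\<lambda>m. paths (2 * m + e) x y / catalan m) \<longlonglongrightarrow> 2 ^ e * (real x + 1) * (real y + 1)"
proof -
  \<comment> \<open>The row of starting point 0 is settled first, by induction on the endpoint with
    the last-step recursion; the first-step recursion then moves the start.\<close>
  have base: "(\<lambda>m. paths (2 * m + e) 0 y / catalan m) \<longlonglongrightarrow> 2 ^ e * (real y + 1)"
    if "even (y + e)" for y e
    using that
  proof (induction y arbitrary: e rule: less_induct)
    case (less y)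
    show ?case
    proof (cases y)
      case 0
      then obtain k where "e = 2 * k" using less.prems by auto
      then show ?thesis using catalan_shift_tendsto[of k] 0 by (simp add: power_mult distrib_left)
    next
      case (Suc z)
      have 1: "(\<lambda>m. paths (2 * m + Suc e) 0 z / catalan m) \<longlonglongrightarrow> 2 ^ Suc e * (real z + 1)"
        using less.IH[of z "Suc e"] less.prems Suc by simp
      \<comment> \<open>The limit \<open>2 ^ e * real z\<close> also covers the killed branch, where
        both sides are 0 at \<open>z = 0\<close>.\<close>
      have 2: "(\<lambda>m. (case z of 0 \<Rightarrow> 0 | Suc z' \<Rightarrow> paths (2 * m + e) 0 z') / catalan m)
          \<longlonglongrightarrow> 2 ^ e * real z"
      proof (cases z)
        case (Suc z')
        then show ?thesis using less.IH[of z' e] less.prems \<open>y = Suc z\<close> by (simp add: add.commute)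
      qed simp
      have "paths (2 * m + e) 0 y / catalan m = paths (2 * m + Suc e) 0 z / catalan m
         - (case z of 0 \<Rightarrow> 0 | Suc z' \<Rightarrow> paths (2 * m + e) 0 z') / catalan m" for m
        using paths_Suc_right[of "2 * m + e" 0 z] Suc by (simp add: diff_divide_distrib[symmetric])
      then have "(\<lambda>m. paths (2 * m + e) 0 y / catalan m)
          \<longlonglongrightarrow> 2 ^ Suc e * (real z + 1) - 2 ^ e * real z"
        using tendsto_diff[OF 1 2] by simp
      moreover have "2 ^ Suc e * (real z + 1) - 2 ^ e * real z = 2 ^ e * (real y + 1)"
        using Suc by (simp add: algebra_simps)
      ultimately show ?thesis by simp
    qed
  qed
  show ?thesis using assms
  proof (induction x arbitrary: e rule: less_induct)
    case (less x)
    show ?case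
    proof (cases x)
      case 0
      then show ?thesis using base less.prems by simp
    next
      case (Suc z)
      have 1: "(\<lambda>m. paths (2 * m + Suc e) z y / catalan m)
          \<longlonglongrightarrow> 2 ^ Suc e * (real z + 1) * (real y + 1)"
        using less.IH[of z "Suc e"] less.prems Suc by simp
      have 2: "(\<lambda>m. (case z of 0 \<Rightarrow> 0 | Suc z' \<Rightarrow> paths (2 * m + e) z' y) / catalan m)
          \<longlonglongrightarrow> 2 ^ e * real z * (real y + 1)"
      proof (cases z)
        case (Suc z')
        then show ?thesis using less.IH[of z' e] less.prems \<open>x = Suc z\<close> by (simp add: add.commute)
      qed simp
      have "paths (2 * m + e) x y / catalan m = paths (2 * m + Suc e) z y / catalan m
         - (case z of 0 \<Rightarrow> 0 | Suc z' \<Rightarrow> paths (2 * m + e) z' y) / catalan m" for m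
        using paths_Suc[of "2 * m + e" z y] Suc by (simp add: diff_divide_distrib[symmetric])
      then have "(\<lambda>m. paths (2 * m + e) x y / catalan m)
          \<longlonglongrightarrow> 2 ^ Suc e * (real z + 1) * (real y + 1) - 2 ^ e * real z * (real y + 1)"
        using tendsto_diff[OF 1 2] by simp
      moreover have "2 ^ Suc e * (real z + 1) * (real y + 1) - 2 ^ e * real z * (real y + 1)
          = 2 ^ e * (real x + 1) * (real y + 1)"
        using Suc by (simp add: algebra_simps)
      ultimately show ?thesis by simp
    qed
  qed
qed

subsection \<open>The hub-and-two-spoke kernel\<close>

locale two_spoke =
  fixes a b :: real
  assumes b_pos: "0 < b" and b_less_a: "b < a" and sum_1: "a + b = 1"
begin

text \<open>With \<open>r\<close> below, an outward step on a spoke weighs \<open>b = s * r\<close>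
  and an inward step \<open>a = s / r\<close>. Each step thus contributes one \<open>s\<close>, and
  the powers of \<open>r\<close> telescope.\<close>

definition s :: real where "s = sqrt (a * b)"
definition r :: real where "r = sqrt (b / a)"

abbreviation K :: "int \<Rightarrow> int \<Rightarrow> real" where "K \<equiv> hub_two_spoke a b"
abbreviation \<rho> :: real where "\<rho> \<equiv> spoke_rho a b"
abbreviation power_K :: "nat \<Rightarrow> int \<Rightarrow> int \<Rightarrow> real" where "power_K \<equiv> kernel_power K"
abbreviation survival :: "nat \<Rightarrow> int \<Rightarrow> real" where "survival n x \<equiv> mass (power_K n x) UNIV"

lemma a_pos: "0 < a"
  using b_pos b_less_a by simp

lemma s_pos: "0 < s" and r_pos: "0 < r"
  using a_pos b_pos by (simp_all add: s_def r_def)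

lemma r_less_1: "r < 1"
  using a_pos b_less_a by (simp add: r_def)

lemma r_square: "r\<^sup>2 = b / a"
  using a_pos b_pos by (simp add: r_def)

lemma s_eq: "s = a * r"
proof -
  have "a * b = a\<^sup>2 * (b / a)" using a_pos by (simp add: power2_eq_square)
  then have "s = sqrt (a\<^sup>2) * r" by (simp only: s_def r_def real_sqrt_mult)
  then show ?thesis using a_pos by simp
qed

lemma s_mult_r: "s * r = b"
  using a_pos r_square by (simp add: s_eq power2_eq_square field_simps)

lemma rho_eq: "\<rho> = 2 * s"
  by (simp add: spoke_rho_def s_def)

text \<open>As \<open>a + b = 1\<close>, this is \<open>(a + b)^2 - 4 * a * b = (a - b)^2\<close>.
  It yields \<open>\<rho> < 1\<close> and later evaluates the masses of the parity classes.\<close>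

lemma one_minus_rho_square: "1 - \<rho>\<^sup>2 = (a - b)\<^sup>2"
proof -
  have "s\<^sup>2 = a * b" using a_pos b_pos by (simp add: s_def)
  then have "1 - \<rho>\<^sup>2 = (a + b)\<^sup>2 - 4 * (a * b)" by (simp add: rho_eq sum_1 power_mult_distrib)
  then show ?thesis by (simp add: power2_eq_square algebra_simps)
qed

lemma rho_square_less_1: "\<rho>\<^sup>2 < 1"
proof -
  have "0 < (a - b)\<^sup>2" using b_less_a by simp
  then show ?thesis using one_minus_rho_square by linarith
qed

lemma rho_pos: "0 < \<rho>" and rho_less_1: "\<rho> < 1"
proof -
  show "0 < \<rho>" using s_pos by (simp add: rho_eq)
  have "\<rho>\<^sup>2 < 1\<^sup>2" using rho_square_less_1 by simp
  then show "\<rho> < 1" by (rule power_less_imp_less_base) simp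
qed

text \<open>Each row is supported on the two neighbours, so the infinite series in
  \<open>kernel_power\<close> collapses to a two-term recursion.\<close>

lemma K_mult_has_sum:
  "((\<lambda>z. K x z * f z) has_sum K x (x + 1) * f (x + 1) + K x (x - 1) * f (x - 1)) UNIV"
proof -
  have "((\<lambda>z. K x z * f z) has_sum (\<Sum>z\<in>{x + 1, x - 1}. K x z * f z)) {x + 1, x - 1}"
    by (rule has_sum_finite) simp
  also have "?this \<longleftrightarrow> ((\<lambda>z. K x z * f z) has_sum (\<Sum>z\<in>{x + 1, x - 1}. K x z * f z)) UNIV"
    by (rule has_sum_cong_neutral) (auto simp: hub_two_spoke_def)
  finally show ?thesis by simp
qed

lemma power_K_Suc:
  "power_K (Suc n) x y = K x (x + 1) * power_K n (x + 1) y + K x (x - 1) * power_K n (x - 1) y"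
  using infsumI[OF K_mult_has_sum[of x "\<lambda>z. power_K n z y"]] by simp

declare kernel_power.simps [simp del]

lemma K_nonneg: "0 \<le> K x y"
  using a_pos b_pos by (simp add: hub_two_spoke_def)

lemma substochastic_K: "substochastic K"
proof -
  have "(K x has_sum K x (x + 1) + K x (x - 1)) UNIV" for x
    using K_mult_has_sum[of x "\<lambda>_. 1"] by simp
  moreover have "K x (x + 1) + K x (x - 1) \<le> 1" for x
    using sum_1 a_pos by (auto simp: hub_two_spoke_def)
  ultimately show ?thesis
    unfolding substochastic_def mass_def using K_nonneg
    by (metis has_sum_imp_summable infsumI)
qed

section \<open>Kernel powers as path counts\<close>

text \<open>Walks on the integers, each departure from the hub weighted by 1/2. The first term is
  the part even in \<open>y\<close>; the signed term is the odd part, to which only walks avoiding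
  the hub contribute, since the others cancel by reflection. At \<open>y = 0\<close> there is no
  mirror image to share the weight with, and at \<open>x = 0\<close> the sign removes the truncated
  predecessor.\<close>

definition spoke_paths :: "nat \<Rightarrow> int \<Rightarrow> int \<Rightarrow> real" where
  "spoke_paths n x y =
     (if y = 0 then paths n (nat \<bar>x\<bar>) 0
      else (paths n (nat \<bar>x\<bar>) (nat \<bar>y\<bar>)
            + sgn (real_of_int (x * y)) * paths n (nat \<bar>x\<bar> - 1) (nat \<bar>y\<bar> - 1)) / 2)"

lemma spoke_paths_minus: "spoke_paths n (- x) (- y) = spoke_paths n x y"
  by (simp add: spoke_paths_def)

lemma spoke_paths_Suc_pos:
  assumes "x > 0"
  shows "spoke_paths (Suc n) x y = spoke_paths n (x + 1) y + spoke_paths n (x - 1) y"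
proof -
  obtain m where x: "x = int (Suc m)"
    using assms by (metis gr0_implies_Suc zero_less_imp_eq_int)
  have 1: "nat \<bar>x\<bar> = Suc m" "nat \<bar>x + 1\<bar> = Suc (Suc m)" "nat \<bar>x - 1\<bar> = m"
    using x by auto
  \<comment> \<open>For \<open>m = 0\<close> the inner neighbour is the hub: its sign is 0, which
    matches the killed branch of \<open>paths\<close> at the shifted endpoint.\<close>
  have 2: "sgn (real_of_int (x * y)) = sgn (real_of_int y)"
    "sgn (real_of_int ((x + 1) * y)) = sgn (real_of_int y)"
    "sgn (real_of_int ((x - 1) * y)) = (if m = 0 then 0 else sgn (real_of_int y))"
    using x by (auto simp: sgn_mult)
  show ?thesis
    unfolding spoke_paths_def 1 2
    by (cases m) (simp_all add: paths_Suc add_divide_distrib algebra_simps)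
qed

text \<open>The negative spoke follows from the positive one by reflecting both endpoints.\<close>

lemma spoke_paths_Suc:
  assumes "x \<noteq> 0"
  shows "spoke_paths (Suc n) x y = spoke_paths n (x + 1) y + spoke_paths n (x - 1) y"
proof (cases "x > 0")
  case False
  then have "spoke_paths (Suc n) (- x) (- y) = spoke_paths n (- x + 1) (- y) + spoke_paths n (- x - 1) (- y)"
    using assms by (intro spoke_paths_Suc_pos) simp
  then show ?thesis
    using spoke_paths_minus[of "Suc n" x y] spoke_paths_minus[of n "x - 1" y]
      spoke_paths_minus[of n "x + 1" y] by simp
qed (rule spoke_paths_Suc_pos)

text \<open>The odd parts started at 1 and -1 cancel, and the even parts agree.\<close>

lemma spoke_paths_Suc_0: "spoke_paths (Suc n) 0 y = (spoke_paths n 1 y + spoke_paths n (- 1) y) / 2"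
  by (simp add: spoke_paths_def paths_Suc sgn_mult) (simp add: field_simps)

lemma spoke_paths_0: "spoke_paths 0 x y = (if x = y then 1 else 0)"
proof (cases "x = 0 \<or> y = 0")
  case True
  then show ?thesis by (auto simp: spoke_paths_def)
next
  case False
  consider "x = y" | "x = - y" "x \<noteq> y" | "\<bar>x\<bar> \<noteq> \<bar>y\<bar>" by linarith
  then show ?thesis
  proof cases
    case 1
    then show ?thesis using False by (simp add: spoke_paths_def sgn_mult)
  next
    \<comment> \<open>At mirror points the even and odd parts are both 1 in absolute value and
      cancel; at equal points they add up to 2.\<close>
    case 2
    then show ?thesis using False by (simp add: spoke_paths_def sgn_mult)
  next
    case 3
    then have "nat \<bar>x\<bar> \<noteq> nat \<bar>y\<bar>" by simp
    \<comment> \<open>Truncated predecessor is injective only on positive numbers.\<close>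
    moreover have "0 < nat \<bar>x\<bar>" "0 < nat \<bar>y\<bar>" using False by simp_all
    ultimately have "nat \<bar>x\<bar> - 1 \<noteq> nat \<bar>y\<bar> - 1" by (metis Suc_diff_1)
    moreover have "x \<noteq> y" using 3 by auto
    ultimately show ?thesis using \<open>nat \<bar>x\<bar> \<noteq> nat \<bar>y\<bar>\<close> False
      by (simp only: spoke_paths_def paths.simps(1) if_False) simp
  qed
qed

lemma power_K_eq: "power_K n x y = s ^ n * r ^ nat \<bar>y\<bar> / r ^ nat \<bar>x\<bar> * spoke_paths n x y"
proof (induction n arbitrary: x)
  case 0
  show ?case using r_pos by (simp add: kernel_power.simps spoke_paths_0)
next
  case (Suc n)
  \<comment> \<open>An outward step trades \<open>b\<close> for \<open>s * r\<close>, cancelling one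
    power of \<open>r\<close> in the denominator; in \<open>into\<close> below,
    \<open>a = s / r\<close> adds one.\<close>
  have out: "b * power_K n z y = s ^ Suc n * r ^ nat \<bar>y\<bar> / r ^ m * spoke_paths n z y"
    if "nat \<bar>z\<bar> = Suc m" for m z
  proof -
    have "b * power_K n z y = (s * r) * power_K n z y" by (simp only: s_mult_r)
    then show ?thesis using r_pos by (simp add: Suc.IH that)
  qed
  have into: "a * power_K n z y = s ^ Suc n * r ^ nat \<bar>y\<bar> / r ^ Suc m * spoke_paths n z y"
    if "nat \<bar>z\<bar> = m" for m z
    using r_pos by (simp add: Suc.IH that s_eq)
  consider "x = 0" | m where "x = int (Suc m)" | m where "x = - int (Suc m)"
    by (metis int_cases2 not0_implies_Suc of_nat_0 neg_0_equal_iff_equal)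
  then show ?case
  proof cases
    case 1
    have "power_K (Suc n) x y = (b * power_K n 1 y + b * power_K n (- 1) y) / 2"
      using 1 by (simp add: power_K_Suc hub_two_spoke_def)
    also have "\<dots> = s ^ Suc n * r ^ nat \<bar>y\<bar> / r ^ 0 * ((spoke_paths n 1 y + spoke_paths n (- 1) y) / 2)"
      by (subst (1 2) out[of _ 0]) (simp_all add: field_simps)
    finally show ?thesis using 1 by (simp add: spoke_paths_Suc_0)
  next
    case (2 m)
    have "power_K (Suc n) x y = b * power_K n (x + 1) y + a * power_K n (x - 1) y"
      using 2 by (simp add: power_K_Suc hub_two_spoke_def)
    also have "\<dots> = s ^ Suc n * r ^ nat \<bar>y\<bar> / r ^ Suc m * (spoke_paths n (x + 1) y + spoke_paths n (x - 1) y)"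
      using 2 out[of "x + 1" "Suc m"] into[of "x - 1" m] by (simp add: distrib_left)
    also have "spoke_paths n (x + 1) y + spoke_paths n (x - 1) y = spoke_paths (Suc n) x y"
      using 2 by (intro spoke_paths_Suc[symmetric]) simp
    also have "Suc m = nat \<bar>x\<bar>" using 2 by simp
    finally show ?thesis .
  next
    case (3 m)
    have "power_K (Suc n) x y = a * power_K n (x + 1) y + b * power_K n (x - 1) y"
      using 3 by (simp add: power_K_Suc hub_two_spoke_def)
    also have "\<dots> = s ^ Suc n * r ^ nat \<bar>y\<bar> / r ^ Suc m * (spoke_paths n (x + 1) y + spoke_paths n (x - 1) y)"
      using 3 out[of "x - 1" "Suc m"] into[of "x + 1" m] by (simp add: distrib_left)
    also have "spoke_paths n (x + 1) y + spoke_paths n (x - 1) y = spoke_paths (Suc n) x y"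
      using 3 by (intro spoke_paths_Suc[symmetric]) simp
    also have "Suc m = nat \<bar>x\<bar>" using 3 by simp
    finally show ?thesis .
  qed
qed

text \<open>Every step changes parity. On path counts, lowering both endpoints by one preserves the
  parity of their sum, so both terms of \<open>spoke_paths\<close> vanish.\<close>

lemma power_K_eq_0:
  assumes "odd (int n + x + y)"
  shows "power_K n x y = 0"
proof -
  have 1: "paths n (nat \<bar>x\<bar>) (nat \<bar>y\<bar>) = 0"
    using assms by (intro paths_eq_0) (auto simp: even_nat_iff)
  have 2: "paths n (nat \<bar>x\<bar> - 1) (nat \<bar>y\<bar> - 1) = 0" if "x \<noteq> 0" "y \<noteq> 0"
    using assms that by (intro paths_eq_0) (auto simp: even_nat_iff)
  have "spoke_paths n x y = 0"
    using 1 2 by (cases "x = 0") (auto simp: spoke_paths_def)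
  then show ?thesis by (simp add: power_K_eq)
qed

section \<open>Asymptotics of the kernel powers\<close>

text \<open>By \<open>power_K_eq\<close> this is the return probability
  \<open>power_K (2 * m) 0 0\<close>, the common yardstick for kernel entries and surviving
  masses.\<close>

definition scale :: "nat \<Rightarrow> real" where "scale m = s ^ (2 * m) * catalan m"

text \<open>The limit of \<open>spoke_paths\<close> relative to \<open>catalan\<close>, without the
  factor \<open>2 ^ e\<close>: the product comes from the even part, the term \<open>x * y\<close>
  from the odd part.\<close>

definition amplitude :: "int \<Rightarrow> int \<Rightarrow> real" where
  "amplitude x y =
     (if y = 0 then \<bar>real_of_int x\<bar> + 1
      else ((\<bar>real_of_int x\<bar> + 1) * (\<bar>real_of_int y\<bar> + 1) + real_of_int (x * y)) / 2)"

lemma scale_pos: "0 < scale m"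
  using s_pos catalan_pos by (simp add: scale_def)

text \<open>Since \<open>x * y\<close> is at least \<open>- \<bar>x * y\<bar>\<close>, the expanded
  numerator is at least \<open>\<bar>x\<bar> + \<bar>y\<bar> + 1\<close>.\<close>

lemma amplitude_pos: "0 < amplitude x y"
proof -
  have "0 \<le> \<bar>real_of_int (x * y)\<bar> + real_of_int (x * y)" by simp
  then have "0 < (\<bar>real_of_int x\<bar> + 1) * (\<bar>real_of_int y\<bar> + 1) + real_of_int (x * y)"
    by (simp add: abs_mult algebra_simps)
  then show ?thesis by (auto simp: amplitude_def intro: add_nonneg_pos)
qed

lemma scale_ratio_tendsto: "(\<lambda>m. scale (Suc m) / scale m) \<longlonglongrightarrow> \<rho>\<^sup>2"
proof -
  have "scale (Suc m) / scale m = s\<^sup>2 * (catalan (m + 1) / catalan m)" for m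
    using s_pos by (simp add: scale_def power2_eq_square)
  then show ?thesis
    using tendsto_mult[OF tendsto_const catalan_shift_tendsto[of 1], of "s\<^sup>2"]
    by (simp add: rho_eq power_mult_distrib mult.commute)
qed

lemma spoke_paths_tendsto:
  assumes "even (x + y + int e)"
  shows "(\<lambda>m. spoke_paths (2 * m + e) x y / catalan m) \<longlonglongrightarrow> 2 ^ e * amplitude x y"
proof (cases "y = 0")
  case True
  have "even (nat \<bar>x\<bar> + 0 + e)" using assms True by (auto simp: even_nat_iff)
  from paths_tendsto[OF this] show ?thesis using True by (simp add: spoke_paths_def amplitude_def)
next
  case False
  have "even (nat \<bar>x\<bar> + nat \<bar>y\<bar> + e)" using assms by (auto simp: even_nat_iff)
  from paths_tendsto[OF this]
  have 1: "(\<lambda>m. paths (2 * m + e) (nat \<bar>x\<bar>) (nat \<bar>y\<bar>) / catalan m)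
      \<longlonglongrightarrow> 2 ^ e * ((\<bar>real_of_int x\<bar> + 1) * (\<bar>real_of_int y\<bar> + 1))" by (simp add: mult.assoc)
  \<comment> \<open>The shift by one turns the factors \<open>\<bar>x\<bar> + 1\<close> and
    \<open>\<bar>y\<bar> + 1\<close> into \<open>\<bar>x\<bar>\<close> and
    \<open>\<bar>y\<bar>\<close>, which the sign combines to \<open>x * y\<close>.\<close>
  have 2: "(\<lambda>m. sgn (real_of_int (x * y)) * (paths (2 * m + e) (nat \<bar>x\<bar> - 1) (nat \<bar>y\<bar> - 1) / catalan m))
      \<longlonglongrightarrow> 2 ^ e * real_of_int (x * y)"
  proof (cases "x = 0")
    case x: False
    have "even (nat \<bar>x\<bar> - 1 + (nat \<bar>y\<bar> - 1) + e)"
      using assms x False by (auto simp: even_nat_iff)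
    from tendsto_mult[OF tendsto_const paths_tendsto[OF this], of "sgn (real_of_int (x * y))"]
    have "(\<lambda>m. sgn (real_of_int (x * y)) * (paths (2 * m + e) (nat \<bar>x\<bar> - 1) (nat \<bar>y\<bar> - 1) / catalan m))
      \<longlonglongrightarrow> sgn (real_of_int (x * y)) * (2 ^ e * (\<bar>real_of_int x\<bar> * \<bar>real_of_int y\<bar>))"
      using x False by (simp add: of_nat_diff mult.assoc nat_le_iff Suc_le_eq)
    moreover have "sgn (real_of_int (x * y)) * (2 ^ e * (\<bar>real_of_int x\<bar> * \<bar>real_of_int y\<bar>))
      = 2 ^ e * real_of_int (x * y)"
      by (simp add: sgn_mult abs_sgn mult_ac)
    ultimately show ?thesis by (simp only:)
  qed simp
  have eq: "spoke_paths (2 * m + e) x y / catalan m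
      = (paths (2 * m + e) (nat \<bar>x\<bar>) (nat \<bar>y\<bar>) / catalan m
        + sgn (real_of_int (x * y)) * (paths (2 * m + e) (nat \<bar>x\<bar> - 1) (nat \<bar>y\<bar> - 1) / catalan m)) / 2" for m
    using False by (simp add: spoke_paths_def add_divide_distrib)
  have "(\<lambda>m. spoke_paths (2 * m + e) x y / catalan m) \<longlonglongrightarrow>
      (2 ^ e * ((\<bar>real_of_int x\<bar> + 1) * (\<bar>real_of_int y\<bar> + 1)) + 2 ^ e * real_of_int (x * y)) / 2"
    unfolding eq by (rule tendsto_divide[OF tendsto_add[OF 1 2] tendsto_const]) simp
  then show ?thesis
    using False by (simp only: amplitude_def if_False distrib_left[symmetric] times_divide_eq_right)
qed

lemma power_K_tendsto:
  assumes "even (x + y + int e)"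
  shows "(\<lambda>m. power_K (2 * m + e) x y / scale m)
    \<longlonglongrightarrow> \<rho> ^ e * r ^ nat \<bar>y\<bar> / r ^ nat \<bar>x\<bar> * amplitude x y"
proof -
  have "power_K (2 * m + e) x y / scale m
      = s ^ e * r ^ nat \<bar>y\<bar> / r ^ nat \<bar>x\<bar> * (spoke_paths (2 * m + e) x y / catalan m)" for m
    using s_pos by (simp add: power_K_eq scale_def power_add)
  then show ?thesis
    using tendsto_mult[OF tendsto_const spoke_paths_tendsto[OF assms],
        of "s ^ e * r ^ nat \<bar>y\<bar> / r ^ nat \<bar>x\<bar>"]
    by (simp add: rho_eq power_mult_distrib mult_ac)
qed

text \<open>The limit is strictly positive. Irreducibility and the cyclic classes are read off from
  this instead of from explicit paths.\<close>

lemma power_K_eventually_pos: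
  assumes "even (x + y + int e)"
  shows "\<forall>\<^sub>F m in sequentially. 0 < power_K (2 * m + e) x y"
proof -
  have "0 < \<rho> ^ e * r ^ nat \<bar>y\<bar> / r ^ nat \<bar>x\<bar> * amplitude x y"
    using rho_pos r_pos amplitude_pos by simp
  from order_tendstoD(1)[OF power_K_tendsto[OF assms] this] show ?thesis
    using scale_pos by (auto simp: zero_less_divide_iff elim!: eventually_mono dest: less_asym)
qed

section \<open>Irreducibility, period and cyclic classes\<close>

lemma irreducible_K: "irreducible_kernel K"
  unfolding irreducible_kernel_def
proof (intro allI)
  fix x y
  have "even (x + y + int (nat \<bar>x + y\<bar>))" by auto
  from power_K_eventually_pos[OF this] show "\<exists>n. 0 < power_K n x y"
    by (auto simp: eventually_sequentially)
qed

lemma period_K: "period K x = 2"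
proof -
  let ?P = "{n. n > 0 \<and> power_K n x x > 0}"
  have "even n" if "n \<in> ?P" for n
  proof (rule ccontr)
    assume "odd n"
    then have "power_K n x x = 0" by (intro power_K_eq_0) auto
    with that show False by simp
  qed
  moreover have "2 \<in> ?P"
    using a_pos b_pos
    by (auto simp: numeral_2_eq_2 power_K_Suc kernel_power.simps(1) hub_two_spoke_def intro!: add_pos_pos)
  ultimately show ?thesis
    unfolding period_def by (intro Gcd_eqI) auto
qed

lemma cyclic_class_K: "cyclic_class K x k = {y. even (x + y + int k)}"
proof -
  have "even (x + y + int k)" if "\<forall>\<^sub>F n in sequentially. power_K (n * 2 + k) x y > 0" for y
  proof (rule ccontr)
    assume "odd (x + y + int k)"
    then have "power_K (n * 2 + k) x y = 0" for n by (intro power_K_eq_0) auto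
    with that show False by simp
  qed
  then show ?thesis
    using power_K_eventually_pos by (auto simp: cyclic_class_def period_K mult.commute)
qed

section \<open>Surviving mass\<close>

lemma power_K_summable: "power_K n x summable_on UNIV"
proof (induction n arbitrary: x)
  case 0
  have "power_K 0 x summable_on {x}" by simp
  also have "?this \<longleftrightarrow> power_K 0 x summable_on UNIV"
    by (rule summable_on_cong_neutral) (auto simp: kernel_power.simps)
  finally show ?case .
next
  case (Suc n)
  have "(\<lambda>y. K x (x + 1) * power_K n (x + 1) y + K x (x - 1) * power_K n (x - 1) y) summable_on UNIV"
    by (intro summable_on_add summable_on_cmult_right Suc.IH)
  then show ?case by (simp add: power_K_Suc[abs_def])
qed

lemma survival_0: "survival 0 x = 1"
proof -
  have "survival 0 x = infsum (power_K 0 x) {x}"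
    unfolding mass_def by (rule infsum_cong_neutral) (auto simp: kernel_power.simps)
  then show ?thesis by (simp add: kernel_power.simps)
qed

lemma survival_Suc:
  "survival (Suc n) x = K x (x + 1) * survival n (x + 1) + K x (x - 1) * survival n (x - 1)"
  unfolding mass_def power_K_Suc[abs_def]
  by (simp add: infsum_add summable_on_cmult_right power_K_summable infsum_cmult_right)

lemma survival_nonneg: "0 \<le> survival n x"
  by (induction n arbitrary: x) (simp_all add: survival_0 survival_Suc K_nonneg)

text \<open>Rows away from the hub have mass 1 and the hub row has mass \<open>b = 1 - a\<close>,
  which is the case \<open>n = 0\<close>. Both sides obey the same linear first-step
  recursion.\<close>

lemma survival_diff: "survival n x - survival (Suc n) x = a * power_K n x 0"
proof (induction n arbitrary: x)
  case 0
  show ?case using sum_1 by (simp only: survival_Suc survival_0) (auto simp: kernel_power.simps hub_two_spoke_def)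
next
  case (Suc n)
  have "survival (Suc n) x - survival (Suc (Suc n)) x
      = K x (x + 1) * (survival n (x + 1) - survival (Suc n) (x + 1))
      + K x (x - 1) * (survival n (x - 1) - survival (Suc n) (x - 1))"
    by (simp only: survival_Suc[of "Suc n"] survival_Suc[of n x]) (simp add: algebra_simps)
  also have "\<dots> = a * power_K (Suc n) x 0"
    by (simp only: Suc.IH power_K_Suc[of n x]) (simp add: algebra_simps)
  finally show ?case .
qed

text \<open>The function \<open>h\<close> below satisfies \<open>K h = \<rho> h\<close> and is at
  least 1 because \<open>r < 1\<close>. Hence the surviving mass, the \<open>n\<close>-th power of
  \<open>K\<close> applied to the constant 1, is at most \<open>\<rho> ^ n * h\<close>.\<close>

lemma survival_le: "survival n x \<le> \<rho> ^ n * ((1 + \<bar>real_of_int x\<bar>) / r ^ nat \<bar>x\<bar>)"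
proof (induction n arbitrary: x)
  case 0
  have "r ^ nat \<bar>x\<bar> \<le> 1 ^ nat \<bar>x\<bar>" using r_pos r_less_1 by (intro power_mono) auto
  then have "1 \<le> (1 + \<bar>real_of_int x\<bar>) / r ^ nat \<bar>x\<bar>"
    using r_pos by (simp add: divide_simps)
  then show ?case by (simp add: survival_0)
next
  case (Suc n)
  have b_div_r: "b / r = s" using r_pos s_mult_r by (simp add: field_simps)
  have a_mult_r: "a * r = s" by (simp add: s_eq)
  define h where "h x = (1 + \<bar>real_of_int x\<bar>) / r ^ nat \<bar>x\<bar>" for x
  have h: "K x (x + 1) * h (x + 1) + K x (x - 1) * h (x - 1) = \<rho> * h x" for x
  proof -
    consider "x = 0" | m where "x = int (Suc m)" | m where "x = - int (Suc m)"
      by (metis int_cases2 not0_implies_Suc of_nat_0 neg_0_equal_iff_equal)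
    then show ?thesis
    proof cases
      case 1
      then show ?thesis using b_div_r by (simp add: h_def hub_two_spoke_def rho_eq)
    next
      case (2 m)
      then have x: "nat \<bar>x + 1\<bar> = Suc (Suc m)" "nat \<bar>x - 1\<bar> = m" "nat \<bar>x\<bar> = Suc m"
        "\<bar>real_of_int x\<bar> = real m + 1" by auto
      have "K x (x + 1) * h (x + 1) + K x (x - 1) * h (x - 1)
          = b / r * ((real m + 3) / r ^ Suc m) + a * r * ((real m + 1) / r ^ Suc m)"
        using 2 x r_pos by (simp add: h_def hub_two_spoke_def add.commute)
      also have "\<dots> = \<rho> * h x"
        unfolding b_div_r a_mult_r h_def rho_eq x by (simp add: add_divide_distrib algebra_simps)
      finally show ?thesis .
    next
      case (3 m)
      then have x: "nat \<bar>x - 1\<bar> = Suc (Suc m)" "nat \<bar>x + 1\<bar> = m" "nat \<bar>x\<bar> = Suc m"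
        "\<bar>real_of_int x\<bar> = real m + 1" by auto
      have "K x (x + 1) * h (x + 1) + K x (x - 1) * h (x - 1)
          = b / r * ((real m + 3) / r ^ Suc m) + a * r * ((real m + 1) / r ^ Suc m)"
        using 3 x r_pos by (simp add: h_def hub_two_spoke_def add.commute)
      also have "\<dots> = \<rho> * h x"
        unfolding b_div_r a_mult_r h_def rho_eq x by (simp add: add_divide_distrib algebra_simps)
      finally show ?thesis .
    qed
  qed
  have "survival (Suc n) x \<le> K x (x + 1) * (\<rho> ^ n * h (x + 1)) + K x (x - 1) * (\<rho> ^ n * h (x - 1))"
    unfolding survival_Suc h_def by (intro add_mono mult_left_mono Suc.IH K_nonneg)
  also have "\<dots> = \<rho> ^ n * (\<rho> * h x)" by (simp only: h[symmetric]) (simp add: algebra_simps)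
  finally show ?case by (simp add: h_def mult_ac)
qed

lemma survival_tendsto_0: "(\<lambda>n. survival n x) \<longlonglongrightarrow> 0"
proof (rule tendsto_sandwich[OF _ _ tendsto_const])
  show "(\<lambda>n. \<rho> ^ n * ((1 + \<bar>real_of_int x\<bar>) / r ^ nat \<bar>x\<bar>)) \<longlonglongrightarrow> 0"
    using rho_pos rho_less_1 by (intro tendsto_mult_left_zero LIMSEQ_realpow_zero) auto
  show "\<forall>\<^sub>F n in sequentially. 0 \<le> survival n x"
    by (rule always_eventually) (rule allI, rule survival_nonneg)
  show "\<forall>\<^sub>F n in sequentially. survival n x \<le> \<rho> ^ n * ((1 + \<bar>real_of_int x\<bar>) / r ^ nat \<bar>x\<bar>)"
    by (rule always_eventually) (rule allI, rule survival_le)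
qed

text \<open>\<open>stolz_ratio\<close> applied along every second time step, with weights
  \<open>scale\<close> and \<open>q = \<rho>\<^sup>2\<close>.\<close>

lemma survival_tendsto_even:
  assumes "even (x + int e)"
  shows "(\<lambda>m. survival (2 * m + e) x / scale m)
    \<longlonglongrightarrow> a * (\<rho> ^ e / r ^ nat \<bar>x\<bar> * (\<bar>real_of_int x\<bar> + 1)) / (1 - \<rho>\<^sup>2)"
proof (rule stolz_ratio[OF scale_pos scale_ratio_tendsto])
  show "\<rho>\<^sup>2 < 1" by (rule rho_square_less_1)
  \<comment> \<open>By parity the walk can be at the hub at only one of two consecutive times, so
    the two-step loss is a single hub term.\<close>
  have "power_K (Suc (2 * m + e)) x 0 = 0" for m
    using assms by (intro power_K_eq_0) auto
  then have "survival (2 * m + e) x - survival (2 * Suc m + e) x = a * power_K (2 * m + e) x 0" for m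
    using survival_diff[of "2 * m + e" x] survival_diff[of "Suc (2 * m + e)" x] by simp
  then show "(\<lambda>m. (survival (2 * m + e) x - survival (2 * Suc m + e) x) / scale m)
      \<longlonglongrightarrow> a * (\<rho> ^ e / r ^ nat \<bar>x\<bar> * (\<bar>real_of_int x\<bar> + 1))"
    using tendsto_mult[OF tendsto_const power_K_tendsto[of x 0 e], of a] assms
    by (simp add: amplitude_def)
  show "(\<lambda>m. survival (2 * m + e) x) \<longlonglongrightarrow> 0"
    using LIMSEQ_subseq_LIMSEQ[OF survival_tendsto_0, of "\<lambda>m. 2 * m + e" x]
    by (simp add: strict_mono_def o_def)
qed

text \<open>For odd \<open>y\<close> the hub cannot be occupied at time \<open>2 * m + e\<close>, so
  no mass is lost in the next step. Passing to offset \<open>Suc e\<close> gives the even case and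
  accounts for the extra \<open>\<rho>\<close>.\<close>

lemma survival_tendsto:
  assumes "even (x + y + int e)"
  shows "(\<lambda>m. survival (2 * m + e) x / scale m)
    \<longlonglongrightarrow> a * (\<rho> ^ e * (if even y then 1 else \<rho>) / r ^ nat \<bar>x\<bar> * (\<bar>real_of_int x\<bar> + 1)) / (1 - \<rho>\<^sup>2)"
proof (cases "even y")
  case True
  then show ?thesis using survival_tendsto_even[of x e] assms by simp
next
  case False
  then have e: "even (x + int (Suc e))" using assms by auto
  have "power_K (2 * m + e) x 0 = 0" for m
    using e by (intro power_K_eq_0) auto
  then have "survival (2 * m + e) x = survival (2 * m + Suc e) x" for m
    using survival_diff[of "2 * m + e" x] by simp
  then show ?thesis
    using survival_tendsto_even[OF e] False by (simp add: mult_ac)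
qed

section \<open>The limiting measure and its parity classes\<close>

text \<open>Merges the two cases of \<open>spoke_limit\<close> and exhibits the
  \<open>amplitude\<close> that governs the kernel entries.\<close>

lemma spoke_limit_eq:
  "spoke_limit a b x y = (1 - \<rho>) / a * r ^ nat \<bar>y\<bar> * amplitude x y / (\<bar>real_of_int x\<bar> + 1)"
proof -
  have "\<bar>real_of_int x\<bar> + 1 \<noteq> 0" by (simp add: add_nonneg_eq_0_iff)
  then show ?thesis
    using a_pos by (simp add: spoke_limit_def amplitude_def r_def) (simp add: field_simps)
qed

text \<open>In the quotient of the two asymptotics \<open>scale\<close>, \<open>\<rho> ^ e\<close>
  and the power of \<open>r\<close> at \<open>x\<close> cancel. The remaining factor
  \<open>1 + \<rho>\<close>, divided by 1 or \<open>\<rho>\<close>, is the reciprocal mass of the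
  parity class of \<open>y\<close>.\<close>

lemma power_K_quotient_tendsto:
  assumes "even (x + y + int e)"
  shows "(\<lambda>m. power_K (2 * m + e) x y / survival (2 * m + e) x)
    \<longlonglongrightarrow> spoke_limit a b x y * (1 + \<rho>) / (if even y then 1 else \<rho>)"
proof -
  let ?c = "if even y then 1 else \<rho>"
  let ?l = "a * (\<rho> ^ e * ?c / r ^ nat \<bar>x\<bar> * (\<bar>real_of_int x\<bar> + 1)) / (1 - \<rho>\<^sup>2)"
  have pos: "0 < ?c" "0 < \<bar>real_of_int x\<bar> + 1" "0 < 1 - \<rho>\<^sup>2"
    using rho_pos rho_square_less_1 by (auto simp: add_nonneg_pos)
  then have "?l \<noteq> 0" using a_pos r_pos rho_pos by simp
  have "scale m \<noteq> 0" for m using scale_pos[of m] by simp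
  then have eq: "(power_K (2 * m + e) x y / scale m) / (survival (2 * m + e) x / scale m)
      = power_K (2 * m + e) x y / survival (2 * m + e) x" for m by simp
  have "1 - \<rho>\<^sup>2 = (1 - \<rho>) * (1 + \<rho>)" by (simp add: power2_eq_square algebra_simps)
  then have "(\<rho> ^ e * r ^ nat \<bar>y\<bar> / r ^ nat \<bar>x\<bar> * amplitude x y) / ?l
      = spoke_limit a b x y * (1 + \<rho>) / ?c"
    unfolding spoke_limit_eq using pos a_pos r_pos rho_pos by (simp add: divide_simps)
  with tendsto_divide[OF power_K_tendsto[OF assms] survival_tendsto[OF assms] \<open>?l \<noteq> 0\<close>]
  show ?thesis by (simp only: eq)
qed

lemma spoke_limit_nonneg: "0 \<le> spoke_limit a b x y"
  unfolding spoke_limit_eq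
  using a_pos r_pos rho_less_1 amplitude_pos[of x y] by (simp add: less_imp_le)

text \<open>The term odd in \<open>y\<close> cancels between mirror points, which is why the class
  masses do not depend on \<open>x\<close>.\<close>

lemma spoke_limit_sum_pair:
  "(if k = 0 then spoke_limit a b x 0 else spoke_limit a b x (int k) + spoke_limit a b x (- int k))
    = (1 - \<rho>) / a * ((real k + 1) * r ^ k)"
proof -
  define t where "t = real_of_int x / (1 + \<bar>real_of_int x\<bar>)"
  show ?thesis
    using a_pos unfolding spoke_limit_def t_def[symmetric] r_def[symmetric]
    by (simp add: field_simps)
qed

lemma spoke_limit_has_sum_even: "(spoke_limit a b x has_sum 1 / (1 + \<rho>)) {z. even z}"
proof -
  have q: "norm (r\<^sup>2) < 1" using r_pos r_less_1 by (simp add: power_less_one_iff)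
  \<comment> \<open>Writing \<open>2 * k + 1 = 2 * (k + 1) - 1\<close> reduces the series to the
    geometric one and its derivative.\<close>
  have "(\<lambda>k. 2 * (real (Suc k) * (r\<^sup>2) ^ k) - (r\<^sup>2) ^ k) sums (2 * (1 / (1 - r\<^sup>2)\<^sup>2) - 1 / (1 - r\<^sup>2))"
    by (intro sums_diff sums_mult geometric_deriv_sums geometric_sums q)
  also have "(\<lambda>k. 2 * (real (Suc k) * (r\<^sup>2) ^ k) - (r\<^sup>2) ^ k) = (\<lambda>k. (real (2 * k) + 1) * r ^ (2 * k))"
    by (simp add: power_mult[symmetric] algebra_simps)
  finally have "(\<lambda>k. (1 - \<rho>) / a * ((real (2 * k) + 1) * r ^ (2 * k)))
      sums ((1 - \<rho>) / a * (2 * (1 / (1 - r\<^sup>2)\<^sup>2) - 1 / (1 - r\<^sup>2)))"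
    by (rule sums_mult)
  moreover have "(1 - \<rho>) / a * (2 * (1 / (1 - r\<^sup>2)\<^sup>2) - 1 / (1 - r\<^sup>2)) = 1 / (1 + \<rho>)"
  proof -
    have "2 * (1 / (1 - r\<^sup>2)\<^sup>2) - 1 / (1 - r\<^sup>2) = (1 + r\<^sup>2) / (1 - r\<^sup>2)\<^sup>2"
      using q by (simp add: divide_simps power2_eq_square) (simp add: algebra_simps)
    also have "\<dots> = a * (a + b) / (a - b)\<^sup>2"
      using a_pos b_less_a unfolding r_square by (simp add: divide_simps) (simp add: power2_eq_square algebra_simps)
    \<comment> \<open>Uses \<open>a + b = 1\<close> and
      \<open>(a - b)\<^sup>2 = 1 - \<rho>\<^sup>2\<close>; the factor \<open>1 - \<rho>\<close>
      cancels the normalisation.\<close>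
    also have "\<dots> = a / ((1 - \<rho>) * (1 + \<rho>))"
      unfolding one_minus_rho_square[symmetric] sum_1 by (simp add: power2_eq_square algebra_simps)
    finally show ?thesis using a_pos rho_less_1 rho_pos by simp
  qed
  ultimately have "(\<lambda>k. (1 - \<rho>) / a * ((real (2 * k) + 1) * r ^ (2 * k))) sums (1 / (1 + \<rho>))"
    by simp
  then have "((\<lambda>k. (1 - \<rho>) / a * ((real (2 * k) + 1) * r ^ (2 * k))) has_sum 1 / (1 + \<rho>)) UNIV"
    using a_pos rho_less_1 r_pos by (intro sums_nonneg_imp_has_sum) (auto simp: less_imp_le)
  then have "((\<lambda>k. (1 - \<rho>) / a * ((real k + 1) * r ^ k)) has_sum 1 / (1 + \<rho>)) (range (\<lambda>k. 2 * k))"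
    by (subst has_sum_reindex) (auto simp: o_def inj_on_def)
  then have "(spoke_limit a b x has_sum 1 / (1 + \<rho>)) {z. nat \<bar>z\<bar> \<in> range (\<lambda>k. 2 * k)}"
    by (intro has_sum_int_from_nat spoke_limit_nonneg) (simp only: spoke_limit_sum_pair)
  also have "{z. nat \<bar>z\<bar> \<in> range (\<lambda>k. 2 * k)} = {z. even z}"
  proof -
    have "n \<in> range (\<lambda>k. 2 * k) \<longleftrightarrow> even n" for n :: nat
      by (auto elim!: evenE)
    then show ?thesis by (auto simp: even_nat_iff)
  qed
  finally show ?thesis .
qed

lemma spoke_limit_has_sum_odd: "(spoke_limit a b x has_sum \<rho> / (1 + \<rho>)) {z. odd z}"
proof -
  have q: "norm (r\<^sup>2) < 1" using r_pos r_less_1 by (simp add: power_less_one_iff)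
  have "(\<lambda>k. 2 * r * (real (Suc k) * (r\<^sup>2) ^ k)) sums (2 * r * (1 / (1 - r\<^sup>2)\<^sup>2))"
    by (intro sums_mult geometric_deriv_sums q)
  also have "(\<lambda>k. 2 * r * (real (Suc k) * (r\<^sup>2) ^ k)) = (\<lambda>k. (real (2 * k + 1) + 1) * r ^ (2 * k + 1))"
    by (simp add: power_mult[symmetric] algebra_simps)
  finally have "(\<lambda>k. (1 - \<rho>) / a * ((real (2 * k + 1) + 1) * r ^ (2 * k + 1)))
      sums ((1 - \<rho>) / a * (2 * r * (1 / (1 - r\<^sup>2)\<^sup>2)))"
    by (rule sums_mult)
  moreover have "(1 - \<rho>) / a * (2 * r * (1 / (1 - r\<^sup>2)\<^sup>2)) = \<rho> / (1 + \<rho>)"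
  proof -
    \<comment> \<open>Grouped so that \<open>2 * (a * r)\<close> can be recognised as
      \<open>\<rho>\<close>.\<close>
    have "2 * r * (1 / (1 - r\<^sup>2)\<^sup>2) = a * (2 * (a * r)) / (a - b)\<^sup>2"
      using a_pos b_less_a unfolding r_square by (simp add: divide_simps) (simp add: power2_eq_square algebra_simps)
    also have "\<dots> = a * \<rho> / ((1 - \<rho>) * (1 + \<rho>))"
      unfolding one_minus_rho_square[symmetric] by (simp add: rho_eq s_eq power2_eq_square algebra_simps)
    finally show ?thesis using a_pos rho_less_1 rho_pos by simp
  qed
  ultimately have "(\<lambda>k. (1 - \<rho>) / a * ((real (2 * k + 1) + 1) * r ^ (2 * k + 1))) sums (\<rho> / (1 + \<rho>))"
    by simp
  then have "((\<lambda>k. (1 - \<rho>) / a * ((real (2 * k + 1) + 1) * r ^ (2 * k + 1))) has_sum \<rho> / (1 + \<rho>)) UNIV"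
    using a_pos rho_less_1 r_pos by (intro sums_nonneg_imp_has_sum) (auto simp: less_imp_le)
  then have "((\<lambda>k. (1 - \<rho>) / a * ((real k + 1) * r ^ k)) has_sum \<rho> / (1 + \<rho>)) (range (\<lambda>k. 2 * k + 1))"
    by (subst has_sum_reindex) (auto simp: o_def inj_on_def)
  then have "(spoke_limit a b x has_sum \<rho> / (1 + \<rho>)) {z. nat \<bar>z\<bar> \<in> range (\<lambda>k. 2 * k + 1)}"
    by (intro has_sum_int_from_nat spoke_limit_nonneg) (simp only: spoke_limit_sum_pair)
  also have "{z. nat \<bar>z\<bar> \<in> range (\<lambda>k. 2 * k + 1)} = {z. odd z}"
  proof -
    have "n \<in> range (\<lambda>k. 2 * k + 1) \<longleftrightarrow> odd n" for n :: nat
      by (auto elim!: oddE)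
    then show ?thesis by (auto simp: even_nat_iff)
  qed
  finally show ?thesis .
qed

lemma mass_spoke_limit:
  "mass (spoke_limit a b x) {z. even z} = 1 / (1 + \<rho>)"
  "mass (spoke_limit a b x) {z. odd z} = \<rho> / (1 + \<rho>)"
  unfolding mass_def
  by (rule infsumI[OF spoke_limit_has_sum_even] infsumI[OF spoke_limit_has_sum_odd])+

lemma probability_mass_spoke_limit: "probability_mass (spoke_limit a b x)"
proof -
  have "(spoke_limit a b x has_sum 1 / (1 + \<rho>) + \<rho> / (1 + \<rho>)) ({z. even z} \<union> {z. odd z})"
    by (rule has_sum_Un_disjoint[OF spoke_limit_has_sum_even spoke_limit_has_sum_odd]) auto
  moreover have "1 / (1 + \<rho>) + \<rho> / (1 + \<rho>) = 1"
    using rho_pos by (simp add: add_divide_distrib[symmetric])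
  moreover have "{z. even z} \<union> {z. odd z} = (UNIV :: int set)" by auto
  ultimately show ?thesis by (simp add: probability_mass_def spoke_limit_nonneg)
qed

lemma power_K_quotient_tendsto_mass:
  assumes "even (x + y + int e)"
  shows "(\<lambda>m. power_K (2 * m + e) x y / survival (2 * m + e) x)
    \<longlonglongrightarrow> spoke_limit a b x y / mass (spoke_limit a b x) {z. even z \<longleftrightarrow> even y}"
proof -
  have "spoke_limit a b x y * (1 + \<rho>) / (if even y then 1 else \<rho>)
      = spoke_limit a b x y / mass (spoke_limit a b x) {z. even z \<longleftrightarrow> even y}"
    using mass_spoke_limit[of x] by simp
  then show ?thesis using power_K_quotient_tendsto[OF assms] by simp
qed

lemma periodic_Yaglom_limit_K: "periodic_Yaglom_limit K x (spoke_limit a b x)"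
  unfolding periodic_Yaglom_limit_def period_K cyclic_class_K
proof (intro conjI allI impI ballI probability_mass_spoke_limit)
  fix k y assume "y \<in> {y. even (x + y + int k)}"
  then have y: "even (x + y + int k)" by simp
  \<comment> \<open>The cyclic class containing \<open>y\<close> consists of the integers of the
    same parity as \<open>y\<close>.\<close>
  then have "{z. even (x + z + int k)} = {z. even z \<longleftrightarrow> even y}" by auto
  with power_K_quotient_tendsto_mass[OF y]
  show "(\<lambda>n. power_K (n * 2 + k) x y / survival (n * 2 + k) x)
      \<longlonglongrightarrow> spoke_limit a b x y / mass (spoke_limit a b x) {z. even (x + z + int k)}"
    by (simp add: mult.commute)
qed

end

theorem theorem5p1:
  fixes a b :: real and K :: "int \<Rightarrow> int \<Rightarrow> real" and \<rho> :: real
    and \<pi> :: "int \<Rightarrow> int \<Rightarrow> real"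
  assumes "0 < b" and "b < 1/2" and "1/2 < a" and "a < 1" and "a + b = 1"
    and "K = hub_two_spoke a b" and "\<rho> = spoke_rho a b" and "\<pi> = spoke_limit a b"
  shows "substochastic K \<and> irreducible_kernel K \<and> (\<forall>x. period K x = 2)
    \<and> (\<forall>x. periodic_Yaglom_limit K x (\<pi> x))
    \<and> (\<forall>x y. even x \<and> even y \<longrightarrow>
          (\<lambda>n. kernel_power K (2*n) x y / mass (kernel_power K (2*n) x) UNIV)
            \<longlonglongrightarrow> \<pi> x y / mass (\<pi> x) {z. even z})
    \<and> (\<forall>x y. even x \<and> odd y \<longrightarrow>
          (\<lambda>n. kernel_power K (2*n+1) x y / mass (kernel_power K (2*n+1) x) UNIV)
            \<longlonglongrightarrow> \<pi> x y / mass (\<pi> x) {z. odd z})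
    \<and> (\<forall>x y. odd x \<and> odd y \<longrightarrow>
          (\<lambda>n. kernel_power K (2*n) x y / mass (kernel_power K (2*n) x) UNIV)
            \<longlonglongrightarrow> \<pi> x y / mass (\<pi> x) {z. odd z})
    \<and> (\<forall>x y. odd x \<and> even y \<longrightarrow>
          (\<lambda>n. kernel_power K (2*n+1) x y / mass (kernel_power K (2*n+1) x) UNIV)
            \<longlonglongrightarrow> \<pi> x y / mass (\<pi> x) {z. even z})
    \<and> (\<forall>x. mass (\<pi> x) {z. even z} = 1 / (1 + \<rho>) \<and> mass (\<pi> x) {z. odd z} = \<rho> / (1 + \<rho>))"
proof -
  interpret two_spoke a b
    using assms by unfold_locales auto
  have mass: "mass (spoke_limit a b x) {z. even z \<longleftrightarrow> even y}
      = (if even y then mass (spoke_limit a b x) {z. even z} else mass (spoke_limit a b x) {z. odd z})"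
    for x y :: int by simp
  \<comment> \<open>Offset 0 covers endpoints of equal parity; offset 1, in
    \<open>odd_times\<close>, covers the others. The parity of \<open>y\<close> then selects the
    class.\<close>
  have even_times: "(\<lambda>n. power_K (2 * n) x y / survival (2 * n) x) \<longlonglongrightarrow> spoke_limit a b x y /
      (if even y then mass (spoke_limit a b x) {z. even z} else mass (spoke_limit a b x) {z. odd z})"
    if "even (x + y)" for x y
    using power_K_quotient_tendsto_mass[of x y 0] that unfolding mass by simp
  have odd_times: "(\<lambda>n. power_K (2 * n + 1) x y / survival (2 * n + 1) x) \<longlonglongrightarrow> spoke_limit a b x y /
      (if even y then mass (spoke_limit a b x) {z. even z} else mass (spoke_limit a b x) {z. odd z})"
    if "odd (x + y)" for x y
    using power_K_quotient_tendsto_mass[of x y 1] that unfolding mass by simp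
  show ?thesis
    unfolding assms(6-8)
  proof (intro conjI allI impI)
    fix x y :: int
    show "substochastic (hub_two_spoke a b)" "irreducible_kernel (hub_two_spoke a b)"
      "period (hub_two_spoke a b) x = 2" "periodic_Yaglom_limit (hub_two_spoke a b) x (spoke_limit a b x)"
      "mass (spoke_limit a b x) {z. even z} = 1 / (1 + spoke_rho a b)"
      "mass (spoke_limit a b x) {z. odd z} = spoke_rho a b / (1 + spoke_rho a b)"
      by (simp_all only: substochastic_K irreducible_K period_K periodic_Yaglom_limit_K mass_spoke_limit)
    show "(\<lambda>n. power_K (2 * n) x y / survival (2 * n) x)
        \<longlonglongrightarrow> spoke_limit a b x y / mass (spoke_limit a b x) {z. even z}" if "even x \<and> even y"
      using even_times[of x y] that by (simp only: even_add simp_thms if_True)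
    show "(\<lambda>n. power_K (2 * n + 1) x y / survival (2 * n + 1) x)
        \<longlonglongrightarrow> spoke_limit a b x y / mass (spoke_limit a b x) {z. odd z}" if "even x \<and> odd y"
      using odd_times[of x y] that by (simp only: even_add simp_thms if_False)
    show "(\<lambda>n. power_K (2 * n) x y / survival (2 * n) x)
        \<longlonglongrightarrow> spoke_limit a b x y / mass (spoke_limit a b x) {z. odd z}" if "odd x \<and> odd y"
      using even_times[of x y] that by (simp only: even_add simp_thms if_False)
    show "(\<lambda>n. power_K (2 * n + 1) x y / survival (2 * n + 1) x)
        \<longlonglongrightarrow> spoke_limit a b x y / mass (spoke_limit a b x) {z. even z}" if "odd x \<and> even y"
      using odd_times[of x y] that by (simp only: even_add simp_thms if_True)
  qed
qed

end
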